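(* Fix $\sigma,b_0,\eta>0$. For every sufficiently large integer $T$, there exist a convex $1$-smooth function $f_T:\mathbb R\to\mathbb R$ with minimum value $f_T^\star=0$ attained at $x^\star=0$, and an oracle $g_t=f_T'(x_t)+\xi_t$, $t\ge1$, with independent identically distributed additive noise $(\xi_t)_{t\ge1}$ satisfying $\mathbb E[g_t\mid\mathcal F_{t-1}]=f_T'(x_t)$ and $\mathbb E[\xi_t^2\mid\mathcal F_{t-1}]\le\sigma^2$ for all $t\ge1$, such that both AdaGrad-Norm and AdaGrad, run with parameters $b_0,\eta$ and initialized at $x_1=1$, satisfy $$\mathbb E[f_T(\bar x_T)-f_T^\star]\ge\frac{\eta\sigma^2}{256\sqrt{b_0^2+\sigma^2/16}} .$$ The objective and noise law may depend on $T$, but the initial distance $|x_1-x^\star|$, the algorithm parameters, the variance bound, and the displayed lower-bound constant do not.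
   Context: A differentiable function $f:\mathbb R\to\mathbb R$ is $1$-smooth if $|f'(x)-f'(y)|\le|x-y|$ for all $x,y$. The uniform average is $\bar x_T=\frac1T\sum_{t=1}^T x_t$. The initialization $x_1$ is deterministic, $\mathcal F_0$ is trivial, and $\mathcal F_t=\sigma(g_1,\dots,g_t)$, so $x_t$ is $\mathcal F_{t-1}$-measurable. Algorithms (dimension one): $b_t^2=b_0^2+\sum_{s=1}^t g_s^2$ with $b_t>0$, and $x_{t+1}=x_t-\eta\, g_t/b_t$ for $t\ge1$. This is the AdaGrad-Norm update in dimension one; coordinate-wise AdaGrad (with its single initial accumulator $b_{0,1}=b_0$) is the same recursion in dimension one, so the two algorithms have the same trajectory. For each $T$, the trajectory is the one generated on the instance $f_T$ and its oracle. *)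

theory Defs
  imports "HOL-Probability.Probability"
begin

definition one_smooth :: "(real \<Rightarrow> real) \<Rightarrow> bool" where
  "one_smooth f \<longleftrightarrow>
     (\<forall>x. f differentiable (at x)) \<and> (\<forall>x y. \<bar>deriv f x - deriv f y\<bar> \<le> \<bar>x - y\<bar>)"

text \<open>
  The two algorithms are relations between the iterates \<open>x\<close> and the observed stochastic
  gradients \<open>g\<close> along one sample path. Time starts at \<open>1\<close>; the values \<open>x 0\<close> and \<open>g 0\<close> are
  irrelevant. Both are stated in any Euclidean space, where they differ; the theorem uses
  them on \<^typ>\<open>real\<close>. In \<open>adagrad\<close>, \<open>\<beta> i\<close> is the initial accumulator of coordinate \<open>i\<close>.
\<close>

definition adagrad_norm ::
  "real \<Rightarrow> real \<Rightarrow> 'a::euclidean_space \<Rightarrow> (nat \<Rightarrow> 'a) \<Rightarrow> (nat \<Rightarrow> 'a) \<Rightarrow> bool" where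
  "adagrad_norm \<eta> b0 x1 x g \<longleftrightarrow>
     x 1 = x1 \<and>
     (\<forall>t\<ge>1. x (t + 1) = x t - (\<eta> / sqrt (b0\<^sup>2 + (\<Sum>s=1..t. (norm (g s))\<^sup>2))) *\<^sub>R g t)"

definition adagrad ::
  "real \<Rightarrow> ('a \<Rightarrow> real) \<Rightarrow> 'a::euclidean_space \<Rightarrow> (nat \<Rightarrow> 'a) \<Rightarrow> (nat \<Rightarrow> 'a) \<Rightarrow> bool" where
  "adagrad \<eta> \<beta> x1 x g \<longleftrightarrow>
     x 1 = x1 \<and>
     (\<forall>t\<ge>1. \<forall>i\<in>Basis.
        x (t + 1) \<bullet> i = x t \<bullet> i - \<eta> * (g t \<bullet> i) / sqrt ((\<beta> i)\<^sup>2 + (\<Sum>s=1..t. (g s \<bullet> i)\<^sup>2)))"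

definition uniform_average :: "(nat \<Rightarrow> real) \<Rightarrow> nat \<Rightarrow> real" where
  "uniform_average x T = (1 / real T) * (\<Sum>t=1..T. x t)"

text \<open>The sigma-algebra generated by \<open>g 1, \<dots>, g t\<close>; it is trivial for \<open>t = 0\<close>.\<close>

definition gradient_filtration :: "'w measure \<Rightarrow> (nat \<Rightarrow> 'w \<Rightarrow> real) \<Rightarrow> nat \<Rightarrow> 'w measure" where
  "gradient_filtration M g t =
     sigma (space M) (\<Union>s\<in>{1..t}. {g s -` A \<inter> space M | A. A \<in> sets borel})"

definition iid_noise :: "'w measure \<Rightarrow> (nat \<Rightarrow> 'w \<Rightarrow> real) \<Rightarrow> bool" where
  "iid_noise M \<xi> \<longleftrightarrow>
     prob_space.indep_vars M (\<lambda>_. borel) \<xi> {1..} \<and>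
     (\<forall>t\<ge>1. distr M borel (\<xi> t) = distr M borel (\<xi> 1))"

text \<open>
  The integrability conditions are needed because \<^const>\<open>real_cond_exp\<close> takes default
  values on functions that are not integrable; in particular the variance bound could then
  hold vacuously.
\<close>

definition additive_noise_oracle ::
  "'w measure \<Rightarrow> real \<Rightarrow> (real \<Rightarrow> real) \<Rightarrow> (nat \<Rightarrow> 'w \<Rightarrow> real) \<Rightarrow>
     (nat \<Rightarrow> 'w \<Rightarrow> real) \<Rightarrow> (nat \<Rightarrow> 'w \<Rightarrow> real) \<Rightarrow> bool" where
  "additive_noise_oracle M \<sigma> f \<xi> x g \<longleftrightarrow>
     (\<forall>t\<ge>1.
        (\<forall>\<omega>\<in>space M. g t \<omega> = deriv f (x t \<omega>) + \<xi> t \<omega>) \<and>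
        integrable M (g t) \<and>
        (AE \<omega> in M. real_cond_exp M (gradient_filtration M g (t - 1)) (g t) \<omega>
                      = deriv f (x t \<omega>)) \<and>
        integrable M (\<lambda>\<omega>. (\<xi> t \<omega>)\<^sup>2) \<and>
        (AE \<omega> in M. real_cond_exp M (gradient_filtration M g (t - 1)) (\<lambda>\<omega>. (\<xi> t \<omega>)\<^sup>2) \<omega>
                      \<le> \<sigma>\<^sup>2))"

end

theory Submission
  imports Defs "HOL-Real_Asymp.Real_Asymp"
begin

text \<open>
  The average iterate is pushed far away by a noise law that looks biased as long as a rare
  compensating value has not occurred. Put \<open>d = \<sigma> / (4 \<surd>T)\<close>. The objective vanishes on
  \<open>x \<ge> 0\<close> and has slopes in \<open>[- d, 0]\<close> on the left. The noise equals
  \<open>2 d\<close> with probability \<open>1 - p\<close>, where \<open>p = 1 / (4 T)\<close>, and otherwise takes the large negative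
  value that makes its mean zero; its second moment is \<open>\<sigma>\<^sup>2 (1 - p)\<close>.

  By the union bound, with probability at least \<open>3/4\<close> no large value shows up before time \<open>T\<close>.
  On this event every observed gradient lies in \<open>[d, 2 d]\<close>, whatever the iterates are. So the
  accumulator is at most \<open>b0\<^sup>2 + 4 T d\<^sup>2 = b0\<^sup>2 + \<sigma>\<^sup>2 / 4\<close>, each step moves the iterate to the left
  by at least \<open>\<eta> d / (2 D)\<close> with \<open>D = \<surd>(b0\<^sup>2 + \<sigma>\<^sup>2 / 16)\<close>, and the average ends up at least
  \<open>(T - 1) \<eta> d / (4 D)\<close> to the left of the start. There the objective has slope \<open>- d\<close>,
  so up to lower-order terms its value is at least \<open>T \<eta> d\<^sup>2 / (4 D) = \<eta> \<sigma>\<^sup>2 / (64 D)\<close>: the powers of \<open>T\<close> cancel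
  (\<open>huber_left_average_no_spike\<close>). The corrections vanish as \<open>T\<close> grows, and the objective is
  nonnegative elsewhere, so the expectation is at least \<open>3/4\<close> of half this value.

  The remaining work is to see that the observations form an oracle in the required sense: the
  iterate \<open>x t\<close> is a function of the past gradients, these are functions of the past noise, and the
  noise at time \<open>t\<close> is independent of the past noise (\<open>additive_noise_oracle_indep\<close>).
\<close>

section \<open>A one-sided Huber function\<close>

definition clip :: "real \<Rightarrow> real \<Rightarrow> real" where
  "clip d x = max (- d) (min x 0)"

text \<open>
  Written out, this is \<open>0\<close> for \<open>x \<ge> 0\<close>, \<open>x\<^sup>2 / 2\<close> on \<open>[- d, 0]\<close> and \<open>- d x - d\<^sup>2 / 2\<close> for \<open>x \<le> - d\<close>.
  The single formula avoids case distinctions: the function is the supremum of the affine functions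
  \<open>m x - m\<^sup>2 / 2\<close> over slopes \<open>m \<in> [- d, 0]\<close>, and \<open>clip d x\<close> is the maximizing slope.
\<close>

definition huber_left :: "real \<Rightarrow> real \<Rightarrow> real" where
  "huber_left d x = clip d x * x - (clip d x)\<^sup>2 / 2"

lemma clip_bounds: "0 \<le> d \<Longrightarrow> - d \<le> clip d x \<and> clip d x \<le> 0"
  by (auto simp: clip_def)

lemma clip_mono: "x \<le> y \<Longrightarrow> clip d x \<le> clip d y"
  by (auto simp: clip_def)

lemma clip_nonexpansive: "\<bar>clip d x - clip d y\<bar> \<le> \<bar>x - y\<bar>"
  by (auto simp: clip_def max_def min_def)

lemma clip_measurable [measurable]: "clip d \<in> borel_measurable borel"
  unfolding clip_def by measurable

text \<open>
  The projection \<open>clip d x\<close> of \<open>x\<close> to \<open>[- d, 0]\<close> lies between \<open>m\<close> and \<open>x\<close>, so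
  \<open>clip d x - m\<close> has the same sign as \<open>(x - clip d x) + (x - m)\<close>; the product of the two is twice
  the claimed gap.
\<close>

lemma huber_left_ge_affine:
  assumes "- d \<le> m" "m \<le> 0"
  shows "m * x - m\<^sup>2 / 2 \<le> huber_left d x"
proof -
  let ?c = "clip d x"
  have "0 \<le> (?c - m) * (2 * x - ?c - m)"
    using assms by (auto simp: clip_def max_def min_def zero_le_mult_iff)
  then show ?thesis
    by (simp add: huber_left_def algebra_simps power2_eq_square)
qed

lemma huber_left_subgradient:
  assumes "0 \<le> d"
  shows "clip d x * (y - x) \<le> huber_left d y - huber_left d x"
  using huber_left_ge_affine[of d "clip d x" y] clip_bounds[OF assms, of x]
  unfolding huber_left_def[of d x] right_diff_distrib by linarith

text \<open>
  The subgradient inequalities at \<open>x\<close> and at \<open>y\<close> enclose the linearization error between \<open>0\<close> and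
  \<open>(clip d y - clip d x) (y - x) \<le> (y - x)\<^sup>2\<close>. This gives the derivative also at the break points.
\<close>

lemma huber_left_deriv:
  assumes "0 \<le> d"
  shows "(huber_left d has_real_derivative clip d x) (at x)"
proof -
  have bound: "\<bar>(huber_left d y - huber_left d x) / (y - x) - clip d x\<bar> \<le> \<bar>y - x\<bar>" if "y \<noteq> x" for y
  proof -
    let ?r = "huber_left d y - huber_left d x - clip d x * (y - x)"
    have "0 \<le> ?r"
      using huber_left_subgradient[OF assms, of x y] by simp
    moreover have "?r \<le> (clip d y - clip d x) * (y - x)"
      using huber_left_subgradient[OF assms, of y x] by (simp add: algebra_simps)
    moreover have "(clip d y - clip d x) * (y - x) \<le> \<bar>y - x\<bar> * \<bar>y - x\<bar>"
      using mult_right_mono[OF clip_nonexpansive[of d y x] abs_ge_zero[of "y - x"]]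
        abs_ge_self[of "(clip d y - clip d x) * (y - x)"]
      by (simp add: abs_mult)
    ultimately have "\<bar>?r\<bar> \<le> \<bar>y - x\<bar> * \<bar>y - x\<bar>" by linarith
    moreover have "(huber_left d y - huber_left d x) / (y - x) - clip d x = ?r / (y - x)"
      using that by (simp add: field_simps)
    ultimately show ?thesis
      using that by (simp add: abs_divide divide_le_eq)
  qed
  have "((\<lambda>y. (huber_left d y - huber_left d x) / (y - x) - clip d x) \<longlongrightarrow> 0) (at x)"
  proof (rule Lim_null_comparison)
    show "\<forall>\<^sub>F y in at x. norm ((huber_left d y - huber_left d x) / (y - x) - clip d x) \<le> \<bar>y - x\<bar>"
      using bound by (auto simp: eventually_at_filter)
    show "((\<lambda>y. \<bar>y - x\<bar>) \<longlongrightarrow> 0) (at x)"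
      by (auto intro!: tendsto_eq_intros)
  qed
  then show ?thesis
    unfolding has_field_derivative_iff by (simp add: LIM_zero_iff)
qed

lemma deriv_huber_left: "0 \<le> d \<Longrightarrow> deriv (huber_left d) = clip d"
  by (intro ext DERIV_imp_deriv huber_left_deriv)

lemma convex_huber_left: "0 \<le> d \<Longrightarrow> convex_on UNIV (huber_left d)"
  by (rule convex_on_realI[where f' = "clip d"]) (auto intro: huber_left_deriv clip_mono)

lemma one_smooth_huber_left: "0 \<le> d \<Longrightarrow> one_smooth (huber_left d)"
  unfolding one_smooth_def
  by (auto simp: deriv_huber_left clip_nonexpansive real_differentiable_def intro: huber_left_deriv)

lemma huber_left_zero [simp]: "0 \<le> d \<Longrightarrow> huber_left d 0 = 0"
  by (simp add: huber_left_def clip_def)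

lemma huber_left_nonneg: "0 \<le> d \<Longrightarrow> 0 \<le> huber_left d x"
  using huber_left_ge_affine[of d 0 x] by simp

lemma huber_left_le: 
  assumes "0 \<le> d" shows "huber_left d x \<le> d * \<bar>x\<bar>"
proof -
  have "clip d x * x \<le> \<bar>clip d x\<bar> * \<bar>x\<bar>"
    by (metis abs_ge_self abs_mult)
  also have "\<dots> \<le> d * \<bar>x\<bar>"
    using clip_bounds[OF assms, of x] by (intro mult_right_mono) auto
  finally have "clip d x * x \<le> d * \<bar>x\<bar>" .
  then show ?thesis
    unfolding huber_left_def using zero_le_power2[of "clip d x"] by linarith
qed

lemma huber_left_measurable [measurable]: "huber_left d \<in> borel_measurable borel"
  unfolding huber_left_def by measurable

section \<open>Conditional expectation of an independent random variable\<close>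

text \<open>
  Testing against \<open>A \<in> F\<close> factorizes: the indicator of \<open>A\<close> and \<open>Y\<close> are independent random variables,
  so the integral of \<open>Y\<close> over \<open>A\<close> is \<open>prob A\<close> times the mean of \<open>Y\<close>.
\<close>

lemma (in prob_space) real_cond_exp_indep:
  fixes Y :: "'a \<Rightarrow> real"
  assumes sub: "subalgebra M F"
    and indep: "indep_set (sets F) (sigma_sets (space M) {Y -` B \<inter> space M | B. B \<in> sets borel})"
    and int: "integrable M Y"
  shows "AE \<omega> in M. real_cond_exp M F Y \<omega> = expectation Y"
proof -
  interpret finite_measure_subalgebra M F
    by unfold_locales (rule sub)
  have spF: "space F = space M"
    using sub by (simp add: subalgebra_def)
  show ?thesis
  proof (rule real_cond_exp_charact)
    fix A assume A: "A \<in> sets F"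
    have AM: "A \<in> sets M"
      using A sub by (auto simp: subalgebra_def)
    have gen: "sigma_sets (space M) {indicator A -` B \<inter> space M | B. B \<in> sets (borel :: real measure)} \<subseteq> sets F"
    proof (rule sets.sigma_sets_subset[of _ F, unfolded spF], safe)
      fix B :: "real set" assume "B \<in> sets borel"
      then show "indicator A -` B \<inter> space M \<in> sets F"
        using measurable_sets[OF borel_measurable_indicator[OF A], of B] by (simp add: spF)
    qed
    have "indep_var borel (indicator A :: _ \<Rightarrow> real) borel Y"
      unfolding indep_var_eq
    proof (intro conjI)
      show "indep_set
          (sigma_sets (space M) {indicator A -` B \<inter> space M | B. B \<in> sets (borel :: real measure)})
          (sigma_sets (space M) {Y -` B \<inter> space M | B. B \<in> sets borel})"
        using indep gen unfolding indep_sets2_eq by (meson subsetD subset_trans)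
    qed (use int AM in auto)
    then have "(\<integral>\<omega>. indicator A \<omega> * Y \<omega> \<partial>M) = (\<integral>\<omega>. indicator A \<omega> \<partial>M) * expectation Y"
      using int AM by (intro indep_var_lebesgue_integral) (auto simp: emeasure_eq_measure)
    then show "(\<integral>\<omega>\<in>A. Y \<omega> \<partial>M) = (\<integral>\<omega>\<in>A. expectation Y \<partial>M)"
      by (simp add: set_lebesgue_integral_def)
  qed (use int in auto)
qed

section \<open>AdaGrad trajectories as stochastic processes\<close>

lemma adagrad_real_iff:
  fixes x g :: "nat \<Rightarrow> real"
  shows "adagrad \<eta> (\<lambda>_. b0) x1 x g \<longleftrightarrow> adagrad_norm \<eta> b0 x1 x g"
  by (simp add: adagrad_def adagrad_norm_def)

lemma adagrad_norm_trajectory: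
  fixes z :: "nat \<Rightarrow> real"
  obtains x g :: "nat \<Rightarrow> real"
  where "adagrad_norm \<eta> b0 x1 x g" "\<And>t. 1 \<le> t \<Longrightarrow> g t = D (x t) + z t"
proof -
  define step where "step = (\<lambda>t (u, S). let h = D u + z (Suc t); S' = S + h\<^sup>2 in (u - \<eta> / sqrt S' * h, S'))"
  define st where "st = rec_nat (x1, b0\<^sup>2) step"
  define x where "x = (\<lambda>t. fst (st (t - 1)))"
  define g where "g = (\<lambda>t. D (x t) + z t)"
  have S: "snd (st t) = b0\<^sup>2 + (\<Sum>s=1..t. (g s)\<^sup>2)" for t
    by (induction t) (auto simp: st_def step_def g_def x_def Let_def split: prod.split)
  have "x (Suc t) = x t - \<eta> / sqrt (b0\<^sup>2 + (\<Sum>s=1..t. (g s)\<^sup>2)) * g t" if t1: "1 \<le> t" for t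
  proof -
    obtain n where t: "t = Suc n" using t1 by (cases t) auto
    have "fst (st (Suc n)) = fst (st n) - \<eta> / sqrt (snd (st (Suc n))) * g t"
      by (simp add: st_def step_def g_def x_def t Let_def split: prod.split)
    then show ?thesis by (simp add: S x_def t)
  qed
  then have "adagrad_norm \<eta> b0 x1 x g"
    by (simp add: adagrad_norm_def) (simp add: x_def st_def)
  then show ?thesis using that g_def by blast
qed

text \<open>
  The next two lemmas speak of an arbitrary \<^typ>\<open>'w measure\<close> \<open>N\<close> because they are applied to three
  sigma-algebras: the one generated by the gradients, the one generated by the noise, and the full one.
\<close>

lemma adagrad_norm_iterate_measurable:
  fixes x g :: "nat \<Rightarrow> 'w \<Rightarrow> real"
  assumes run: "\<And>\<omega>. \<omega> \<in> space N \<Longrightarrow> adagrad_norm \<eta> b0 x1 (\<lambda>t. x t \<omega>) (\<lambda>t. g t \<omega>)"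
    and g: "\<And>s. s \<in> {1..n} \<Longrightarrow> g s \<in> borel_measurable N"
  shows "x (Suc n) \<in> borel_measurable N"
  using g
proof (induction n)
  case 0
  have "x 1 \<in> borel_measurable N \<longleftrightarrow> (\<lambda>_. x1) \<in> borel_measurable N"
    using run by (intro measurable_cong) (simp add: adagrad_norm_def)
  then show ?case by simp
next
  case (Suc n)
  have [measurable]: "x (Suc n) \<in> borel_measurable N" "g (Suc n) \<in> borel_measurable N"
    using Suc by auto
  have [measurable]: "(\<lambda>\<omega>. \<Sum>s=1..Suc n. (g s \<omega>)\<^sup>2) \<in> borel_measurable N"
    using Suc.prems by (intro borel_measurable_sum borel_measurable_power) auto
  have "x (Suc (Suc n)) \<in> borel_measurable N \<longleftrightarrow>
    (\<lambda>\<omega>. x (Suc n) \<omega> - \<eta> / sqrt (b0\<^sup>2 + (\<Sum>s=1..Suc n. (g s \<omega>)\<^sup>2)) * g (Suc n) \<omega>) \<in> borel_measurable N"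
    using run unfolding adagrad_norm_def by (intro measurable_cong) force
  also have "\<dots>" by measurable
  finally show ?case .
qed

lemma adagrad_norm_gradient_measurable:
  fixes x g \<xi> :: "nat \<Rightarrow> 'w \<Rightarrow> real"
  assumes run: "\<And>\<omega>. \<omega> \<in> space N \<Longrightarrow> adagrad_norm \<eta> b0 x1 (\<lambda>t. x t \<omega>) (\<lambda>t. g t \<omega>)"
    and g: "\<And>t \<omega>. 1 \<le> t \<Longrightarrow> \<omega> \<in> space N \<Longrightarrow> g t \<omega> = D (x t \<omega>) + \<xi> t \<omega>"
    and D [measurable]: "D \<in> borel_measurable borel"
    and \<xi>: "\<And>s. s \<in> {1..n} \<Longrightarrow> \<xi> s \<in> borel_measurable N"
    and "s \<in> {1..n}"
  shows "g s \<in> borel_measurable N"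
  using \<open>s \<in> {1..n}\<close>
proof (induction s rule: less_induct)
  case (less s)
  then obtain k where k: "s = Suc k" by (cases s) auto
  have [measurable]: "x s \<in> borel_measurable N"
    unfolding k by (rule adagrad_norm_iterate_measurable[OF run]) (use less k in auto)
  have [measurable]: "\<xi> s \<in> borel_measurable N"
    using \<xi> less by auto
  have "g s \<in> borel_measurable N \<longleftrightarrow> (\<lambda>\<omega>. D (x s \<omega>) + \<xi> s \<omega>) \<in> borel_measurable N"
    using less by (intro measurable_cong g) auto
  then show ?case by simp
qed

lemma space_gradient_filtration [simp]: "space (gradient_filtration M g t) = space M"
  by (simp add: gradient_filtration_def space_measure_of_conv)

lemma sets_gradient_filtration:
  "sets (gradient_filtration M g t) =
    sigma_sets (space M) (\<Union>s\<in>{1..t}. {g s -` A \<inter> space M | A. A \<in> sets borel})"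
  unfolding gradient_filtration_def by (rule sets_measure_of) auto

lemma gradient_filtration_measurable:
  "s \<in> {1..t} \<Longrightarrow> g s \<in> borel_measurable (gradient_filtration M g t)"
proof (rule measurableI)
  fix A :: "real set" assume "s \<in> {1..t}" "A \<in> sets borel"
  then have "g s -` A \<inter> space M \<in> (\<Union>s\<in>{1..t}. {g s -` A \<inter> space M | A. A \<in> sets borel})"
    by (intro UN_I[of s]) auto
  then show "g s -` A \<inter> space (gradient_filtration M g t) \<in> sets (gradient_filtration M g t)"
    by (simp only: sets_gradient_filtration space_gradient_filtration sigma_sets.Basic)
qed auto

lemma gradient_filtration_least:
  assumes "space N = space M" "\<And>s. s \<in> {1..t} \<Longrightarrow> g s \<in> borel_measurable N"
  shows "sets (gradient_filtration M g t) \<subseteq> sets N"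
  unfolding sets_gradient_filtration
proof (rule sets.sigma_sets_subset'[of _ N, unfolded assms(1)])
  show "(\<Union>s\<in>{1..t}. {g s -` A \<inter> space M |A. A \<in> sets borel}) \<subseteq> sets N"
    using measurable_sets[OF assms(2)] by (auto simp: assms(1))
  show "space M \<in> sets N"
    using sets.top[of N] by (simp add: assms(1))
qed

text \<open>
  The gradients up to time \<open>n\<close> are functions of the noise up to time \<open>n\<close>, so the filtration at \<open>n\<close> is
  contained in the sigma-algebra \<open>V\<close> of the past noise, which is independent of the noise at time
  \<open>n + 1\<close>. The noise thus contributes its plain mean and second moment, while the derivative at the
  iterate is measurable with respect to the filtration and is not averaged.
\<close>

lemma (in prob_space) additive_noise_oracle_indep:
  fixes x g \<xi> :: "nat \<Rightarrow> 'a \<Rightarrow> real"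
  assumes run: "\<And>\<omega>. \<omega> \<in> space M \<Longrightarrow> adagrad_norm \<eta> b0 x1 (\<lambda>t. x t \<omega>) (\<lambda>t. g t \<omega>)"
    and g: "\<And>t \<omega>. 1 \<le> t \<Longrightarrow> \<omega> \<in> space M \<Longrightarrow> g t \<omega> = deriv f (x t \<omega>) + \<xi> t \<omega>"
    and D [measurable]: "deriv f \<in> borel_measurable borel"
    and bound: "\<And>y. \<bar>deriv f y\<bar> \<le> K"
    and indep: "indep_vars (\<lambda>_. borel) \<xi> {1..}"
    and int: "\<And>t. 1 \<le> t \<Longrightarrow> integrable M (\<xi> t)" "\<And>t. 1 \<le> t \<Longrightarrow> integrable M (\<lambda>\<omega>. (\<xi> t \<omega>)\<^sup>2)"
    and mean: "\<And>t. 1 \<le> t \<Longrightarrow> expectation (\<xi> t) = 0"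
    and var: "\<And>t. 1 \<le> t \<Longrightarrow> expectation (\<lambda>\<omega>. (\<xi> t \<omega>)\<^sup>2) \<le> \<sigma>\<^sup>2"
  shows "additive_noise_oracle M \<sigma> f \<xi> x g"
  unfolding additive_noise_oracle_def
proof (intro allI impI conjI ballI)
  fix t :: nat assume t: "1 \<le> t"
  define n where "n = t - 1"
  have tn: "t = Suc n" using t by (simp add: n_def)
  define F where "F = gradient_filtration M g n"
  define X where "X = (\<lambda>\<omega>. restrict (\<lambda>i. \<xi> i \<omega>) {1..n})"
  define H where "H = PiM {1..n} (\<lambda>_. borel :: real measure)"
  define V where "V = vimage_algebra (space M) X H"
  have \<xi>M: "\<xi> s \<in> borel_measurable M" if "1 \<le> s" for s
    using indep that by (auto simp: indep_vars_def)
  \<comment> \<open>The noise at time \<open>t\<close> enters as a family with index set \<open>{t}\<close>, since independence of two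
    random variables is only defined for a common range type.\<close>
  define R where "R = (\<lambda>\<omega>. restrict (\<lambda>i. \<xi> i \<omega>) {t})"
  have "indep_var H X (PiM {t} (\<lambda>_. borel)) R"
    unfolding H_def X_def R_def by (rule indep_var_restrict[OF indep]) (auto simp: tn)
  then have X: "X \<in> measurable M H" and R: "R \<in> measurable M (PiM {t} (\<lambda>_. borel))"
    and indepXR: "indep_set (sigma_sets (space M) {X -` A \<inter> space M | A. A \<in> sets H})
      (sigma_sets (space M) {R -` A \<inter> space M | A. A \<in> sets (PiM {t} (\<lambda>_. borel))})"
    unfolding indep_var_eq by auto
  have XV: "X \<in> measurable V H"
    unfolding V_def using measurable_space[OF X] by (intro measurable_vimage_algebra1) auto
  have \<xi>V: "\<xi> s \<in> borel_measurable V" if "s \<in> {1..n}" for s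
  proof -
    have "(\<lambda>\<omega>. X \<omega> s) \<in> borel_measurable V"
      using measurable_compose[OF XV, of "\<lambda>h. h s" borel] that by (simp add: H_def)
    then show ?thesis using that by (simp add: X_def)
  qed
  have VX: "sets V \<subseteq> sigma_sets (space M) {X -` A \<inter> space M | A. A \<in> sets H}"
    unfolding V_def sets_vimage_algebra by simp
  have spV: "space V = space M" by (simp add: V_def)
  have gV: "g s \<in> borel_measurable V" if "s \<in> {1..n}" for s
  proof (rule adagrad_norm_gradient_measurable[OF _ _ D \<xi>V that])
    show "adagrad_norm \<eta> b0 x1 (\<lambda>t. x t \<omega>) (\<lambda>t. g t \<omega>)" if "\<omega> \<in> space V" for \<omega>
      using run that spV by blast
    show "g t \<omega> = deriv f (x t \<omega>) + \<xi> t \<omega>" if "1 \<le> t" "\<omega> \<in> space V" for t \<omega>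
      using g that spV by blast
  qed
  have gM: "g s \<in> borel_measurable M" if "1 \<le> s" for s
    by (rule adagrad_norm_gradient_measurable[OF run g D, where n = s]) (use \<xi>M that in auto)
  have FV: "sets F \<subseteq> sets V"
    unfolding F_def by (rule gradient_filtration_least[OF spV gV])
  have FM: "sets F \<subseteq> sets M"
    unfolding F_def by (rule gradient_filtration_least[OF refl]) (use gM in auto)
  have sub: "subalgebra M F"
    using FM by (simp add: subalgebra_def F_def)
  have indepF: "indep_set (sets F)
      (sigma_sets (space M) {(\<lambda>\<omega>. h (\<xi> t \<omega>)) -` B \<inter> space M | B. B \<in> sets borel})"
    if h: "h \<in> borel_measurable borel" for h :: "real \<Rightarrow> real"
  proof -
    have "sigma_sets (space M) {(\<lambda>\<omega>. h (\<xi> t \<omega>)) -` B \<inter> space M | B. B \<in> sets borel} \<subseteq>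
      sigma_sets (space M) {R -` A \<inter> space M | A. A \<in> sets (PiM {t} (\<lambda>_. borel))}"
    proof (rule sigma_sets_subseteq, safe)
      fix B :: "real set" assume B: "B \<in> sets borel"
      let ?P = "PiM {t} (\<lambda>_. borel :: real measure)"
      have "(\<lambda>r. r t) \<in> measurable ?P borel"
        by (rule measurable_component_singleton) simp
      then have "(\<lambda>r. h (r t)) \<in> borel_measurable ?P"
        using h by (rule measurable_compose)
      then have "(\<lambda>r. h (r t)) -` B \<inter> space ?P \<in> sets ?P"
        using B by (rule measurable_sets)
      moreover have "(\<lambda>\<omega>. h (\<xi> t \<omega>)) -` B \<inter> space M = R -` ((\<lambda>r. h (r t)) -` B \<inter> space ?P) \<inter> space M"
        using measurable_space[OF R] by (auto simp: R_def)
      ultimately show "\<exists>A. (\<lambda>\<omega>. h (\<xi> t \<omega>)) -` B \<inter> space M = R -` A \<inter> space M \<and> A \<in> sets ?P"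
        by blast
    qed
    then show ?thesis
      using indepXR FV VX unfolding indep_sets2_eq by (meson subsetD subset_trans)
  qed
  interpret F: finite_measure_subalgebra M F
    by unfold_locales (rule sub)
  have "x (Suc n) \<in> borel_measurable F"
  proof (rule adagrad_norm_iterate_measurable)
    show "adagrad_norm \<eta> b0 x1 (\<lambda>t. x t \<omega>) (\<lambda>t. g t \<omega>)" if "\<omega> \<in> space F" for \<omega>
      using run that by (simp add: F_def)
    show "g s \<in> borel_measurable F" if "s \<in> {1..n}" for s
      unfolding F_def by (rule gradient_filtration_measurable[OF that])
  qed
  then have xF: "x t \<in> borel_measurable F" by (simp add: tn)
  then have DF: "(\<lambda>\<omega>. deriv f (x t \<omega>)) \<in> borel_measurable F"
    using D by (rule measurable_compose)
  then have DM: "(\<lambda>\<omega>. deriv f (x t \<omega>)) \<in> borel_measurable M"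
    using measurable_from_subalg[OF sub] by blast
  have Dint: "integrable M (\<lambda>\<omega>. deriv f (x t \<omega>))"
    using bound by (intro integrable_const_bound[where B = K] DM) auto
  show gt: "g t \<omega> = deriv f (x t \<omega>) + \<xi> t \<omega>" if "\<omega> \<in> space M" for \<omega>
    by (rule g[OF t that])
  show "integrable M (g t)"
    using Dint int(1)[OF t] by (subst Bochner_Integration.integrable_cong[OF refl gt]) auto
  have "AE \<omega> in M. real_cond_exp M F (g t) \<omega> = real_cond_exp M F (\<lambda>\<omega>. deriv f (x t \<omega>) + \<xi> t \<omega>) \<omega>"
    by (rule F.real_cond_exp_cong) (use gt gM[OF t] DM \<xi>M[OF t] in auto)
  moreover note F.real_cond_exp_add[OF Dint int(1)[OF t]] F.real_cond_exp_F_meas[OF Dint DF]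
    real_cond_exp_indep[OF sub indepF[of "\<lambda>z. z", simplified] int(1)[OF t]]
  ultimately have "AE \<omega> in M. real_cond_exp M F (g t) \<omega> = deriv f (x t \<omega>)"
    by eventually_elim (simp add: mean[OF t])
  then show "AE \<omega> in M. real_cond_exp M (gradient_filtration M g (t - 1)) (g t) \<omega> = deriv f (x t \<omega>)"
    by (simp add: F_def n_def)
  show "integrable M (\<lambda>\<omega>. (\<xi> t \<omega>)\<^sup>2)"
    by (rule int(2)[OF t])
  from real_cond_exp_indep[OF sub indepF[of "\<lambda>z. z\<^sup>2", simplified] int(2)[OF t]]
  have "AE \<omega> in M. real_cond_exp M F (\<lambda>\<omega>. (\<xi> t \<omega>)\<^sup>2) \<omega> \<le> \<sigma>\<^sup>2"
    by eventually_elim (simp add: var[OF t])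
  then show "AE \<omega> in M. real_cond_exp M (gradient_filtration M g (t - 1)) (\<lambda>\<omega>. (\<xi> t \<omega>)\<^sup>2) \<omega> \<le> \<sigma>\<^sup>2"
    by (simp add: F_def n_def)
qed

section \<open>Displacement along a trajectory\<close>

lemma adagrad_norm_step:
  fixes x g :: "nat \<Rightarrow> real"
  assumes "adagrad_norm \<eta> b0 x1 x g"
  shows "x (Suc (Suc t)) = x (Suc t) - \<eta> * (g (Suc t) / sqrt (b0\<^sup>2 + (\<Sum>s=1..Suc t. (g s)\<^sup>2)))"
  using assms unfolding adagrad_norm_def by (auto simp del: sum.cl_ivl_Suc)

text \<open>
  The accumulator at time \<open>t\<close> already contains the gradient of time \<open>t\<close>, so the normalized gradient has
  modulus at most \<open>1\<close>. This keeps the average iterate bounded for any gradients, which is what makes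
  the expected objective a finite integral.
\<close>

lemma adagrad_norm_bounded:
  fixes x g :: "nat \<Rightarrow> real"
  assumes run: "adagrad_norm \<eta> b0 x1 x g" and "0 \<le> \<eta>"
  shows "\<bar>x (Suc t)\<bar> \<le> \<bar>x1\<bar> + \<eta> * real t"
proof (induction t)
  case 0
  then show ?case using run by (simp add: adagrad_norm_def)
next
  case (Suc t)
  define b where "b = sqrt (b0\<^sup>2 + (\<Sum>s=1..Suc t. (g s)\<^sup>2))"
  have "(g (Suc t))\<^sup>2 \<le> b0\<^sup>2 + (\<Sum>s=1..Suc t. (g s)\<^sup>2)"
    by (simp add: sum_nonneg)
  then have b: "\<bar>g (Suc t)\<bar> \<le> b"
    unfolding b_def by (intro real_le_rsqrt) auto
  then have "\<bar>g (Suc t) / b\<bar> \<le> 1"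
    by (auto simp: abs_divide divide_le_eq_1)
  then have "\<eta> * \<bar>g (Suc t) / b\<bar> \<le> \<eta>"
    using mult_left_mono[of "\<bar>g (Suc t) / b\<bar>" 1 \<eta>] \<open>0 \<le> \<eta>\<close> by simp
  then have "\<bar>\<eta> * (g (Suc t) / b)\<bar> \<le> \<eta>"
    using \<open>0 \<le> \<eta>\<close> by (simp add: abs_mult)
  moreover have "x (Suc (Suc t)) = x (Suc t) - \<eta> * (g (Suc t) / b)"
    unfolding b_def by (rule adagrad_norm_step[OF run])
  moreover have "\<eta> * real (Suc t) = \<eta> * real t + \<eta>"
    by (simp add: algebra_simps)
  ultimately show ?case
    using Suc by linarith
qed

lemma adagrad_norm_drift:
  fixes x g :: "nat \<Rightarrow> real"
  assumes run: "adagrad_norm \<eta> b0 x1 x g" and "0 \<le> \<eta>" "0 < b0" "0 \<le> d" "0 < R"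
    and g: "\<And>s. s \<in> {1..T} \<Longrightarrow> d \<le> g s"
    and R: "b0\<^sup>2 + (\<Sum>s=1..T. (g s)\<^sup>2) \<le> R\<^sup>2"
    and "t \<le> T"
  shows "x (Suc t) \<le> x1 - real t * (\<eta> * d / R)"
  using \<open>t \<le> T\<close>
proof (induction t)
  case 0
  then show ?case using run by (simp add: adagrad_norm_def)
next
  case (Suc t)
  define b where "b = sqrt (b0\<^sup>2 + (\<Sum>s=1..Suc t. (g s)\<^sup>2))"
  have "0 < b0\<^sup>2 + (\<Sum>s=1..Suc t. (g s)\<^sup>2)"
    using \<open>0 < b0\<close> by (intro add_pos_nonneg sum_nonneg) auto
  then have b0: "0 < b" unfolding b_def by (rule real_sqrt_gt_zero)
  have "(\<Sum>s=1..Suc t. (g s)\<^sup>2) \<le> (\<Sum>s=1..T. (g s)\<^sup>2)"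
    using Suc.prems by (intro sum_mono2) auto
  then have "b \<le> R"
    unfolding b_def using R \<open>0 < R\<close> by (intro real_le_lsqrt) auto
  then have "d / R \<le> g (Suc t) / b"
    using b0 g[of "Suc t"] Suc.prems \<open>0 \<le> d\<close> by (intro frac_le) auto
  then have "\<eta> * (d / R) \<le> \<eta> * (g (Suc t) / b)"
    using \<open>0 \<le> \<eta>\<close> by (rule mult_left_mono)
  moreover have "x (Suc (Suc t)) = x (Suc t) - \<eta> * (g (Suc t) / b)"
    unfolding b_def by (rule adagrad_norm_step[OF run])
  moreover have "real (Suc t) * (\<eta> * d / R) = real t * (\<eta> * d / R) + \<eta> * (d / R)"
    by (simp add: algebra_simps add_divide_distrib)
  ultimately show ?case
    using Suc by linarith
qed

lemma uniform_average_drift: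
  assumes "1 \<le> T" and x: "\<And>t. t < T \<Longrightarrow> x (Suc t) \<le> c - real t * d"
  shows "uniform_average x T \<le> c - (real T - 1) / 2 * d"
proof -
  have "(\<Sum>t=1..T. x t) = (\<Sum>t<T. x (Suc t))"
    by (simp add: sum.shift_bounds_cl_Suc_ivl sum.atLeast1_atMost_eq)
  also have "\<dots> \<le> (\<Sum>t<T. c - real t * d)"
    by (intro sum_mono x) auto
  also have "\<dots> = real T * c - (\<Sum>t<T. real t) * d"
    by (simp add: sum_subtractf sum_distrib_right)
  also have "(\<Sum>t<T. real t) = real T * (real T - 1) / 2"
    by (induction T) (auto simp: field_simps)
  finally have "(\<Sum>t=1..T. x t) \<le> real T * (c - (real T - 1) / 2 * d)"
    by (simp add: algebra_simps)
  then show ?thesis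
    using assms(1) by (simp add: uniform_average_def field_simps)
qed

lemma uniform_average_bounded:
  assumes "\<And>t. t \<in> {1..T} \<Longrightarrow> \<bar>x t\<bar> \<le> B" "1 \<le> T"
  shows "\<bar>uniform_average x T\<bar> \<le> B"
proof -
  have "\<bar>\<Sum>t=1..T. x t\<bar> \<le> (\<Sum>t=1..T. \<bar>x t\<bar>)" by (rule sum_abs)
  also have "\<dots> \<le> real T * B"
    using sum_bounded_above[of "{1..T}" "\<lambda>t. \<bar>x t\<bar>" B] assms by simp
  finally show ?thesis
    using assms(2) by (simp add: uniform_average_def abs_mult field_simps)
qed

section \<open>Noise with rare large spikes\<close>

text \<open>
  The value of the spike is forced by the requirement that the mean be zero.
\<close>

definition spike_noise :: "real \<Rightarrow> real \<Rightarrow> real measure" where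
  "spike_noise p a = distr (bernoulli_pmf p) borel (\<lambda>s. if s then - a * (1 - p) / p else a)"

lemma prob_space_spike_noise: "prob_space (spike_noise p a)"
  unfolding spike_noise_def by (rule measure_pmf.prob_space_distr) simp

lemma sets_spike_noise [simp, measurable_cong]: "sets (spike_noise p a) = sets borel"
  by (simp add: spike_noise_def)

lemma
  fixes h :: "real \<Rightarrow> real"
  assumes [measurable]: "h \<in> borel_measurable borel" and p: "0 < p" "p < 1"
  shows integrable_spike_noise: "integrable (spike_noise p a) h"
    and integral_spike_noise:
      "(\<integral>z. h z \<partial>spike_noise p a) = h (- a * (1 - p) / p) * p + h a * (1 - p)"
proof -
  show "integrable (spike_noise p a) h"
    unfolding spike_noise_def
    by (subst integrable_distr_eq) (auto intro!: integrable_measure_pmf_finite)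
  show "(\<integral>z. h z \<partial>spike_noise p a) = h (- a * (1 - p) / p) * p + h a * (1 - p)"
    unfolding spike_noise_def using p by (subst integral_distr) auto
qed

lemma spike_noise_mean:
  assumes "0 < p" "p < 1"
  shows "(\<integral>z. z \<partial>spike_noise p a) = 0"
  using assms by (subst integral_spike_noise) (auto simp: field_simps)

lemma spike_noise_second_moment:
  assumes "0 < p" "p < 1"
  shows "(\<integral>z. z\<^sup>2 \<partial>spike_noise p a) = a\<^sup>2 * (1 - p) / p"
  using assms by (subst integral_spike_noise) (auto simp: field_simps power2_eq_square)

lemma spike_noise_spike_prob:
  assumes "0 < p" "p < 1"
  shows "measure (spike_noise p a) (- {a}) \<le> p"
proof -
  interpret prob_space "spike_noise p a" by (rule prob_space_spike_noise)
  have "measure (spike_noise p a) (- {a}) = (\<integral>z. indicator (- {a}) z \<partial>spike_noise p a)"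
    by (simp add: spike_noise_def)
  also have "\<dots> \<le> p"
    using assms by (subst integral_spike_noise) (auto simp: indicator_def)
  finally show ?thesis .
qed

definition spike_noise_space :: "real \<Rightarrow> real \<Rightarrow> (nat \<Rightarrow> real) measure" where
  "spike_noise_space p a = PiM UNIV (\<lambda>_. spike_noise p a)"

lemma space_spike_noise_space [simp]: "space (spike_noise_space p a) = UNIV"
  using sets_eq_imp_space_eq[OF sets_spike_noise[of p a]]
  by (auto simp: spike_noise_space_def space_PiM)

lemma prob_space_spike_noise_space: "prob_space (spike_noise_space p a)"
  unfolding spike_noise_space_def by (intro prob_space_PiM prob_space_spike_noise)

lemma coordinate_measurable [measurable]: "(\<lambda>\<omega>. \<omega> t) \<in> borel_measurable (spike_noise_space p a)"
proof -
  have "(\<lambda>\<omega>. \<omega> t) \<in> measurable (spike_noise_space p a) (spike_noise p a)"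
    unfolding spike_noise_space_def by (rule measurable_component_singleton) simp
  then show ?thesis by (simp cong: measurable_cong_sets)
qed

lemma distr_coordinate: "distr (spike_noise_space p a) borel (\<lambda>\<omega>. \<omega> t) = spike_noise p a"
proof -
  have "distr (spike_noise_space p a) (spike_noise p a) (\<lambda>\<omega>. \<omega> t) = spike_noise p a"
    unfolding spike_noise_space_def
    using distr_PiM_component[of UNIV "\<lambda>_. spike_noise p a" t] prob_space_spike_noise by simp
  then show ?thesis
    by (simp cong: distr_cong)
qed

lemma iid_noise_coordinates: "iid_noise (spike_noise_space p a) (\<lambda>t \<omega>. \<omega> t)"
proof -
  let ?M = "spike_noise_space p a"
  interpret prob_space ?M by (rule prob_space_spike_noise_space)
  have "indep_vars (\<lambda>_. borel) (\<lambda>t \<omega>. \<omega> t) (UNIV :: nat set)"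
  proof (subst indep_vars_iff_distr_eq_PiM)
    have s: "sets ?M = sets (PiM UNIV (\<lambda>_. borel))"
      unfolding spike_noise_space_def by (rule sets_PiM_cong) auto
    have "distr ?M (PiM UNIV (\<lambda>_. borel)) (\<lambda>\<omega>. \<lambda>i\<in>UNIV. \<omega> i) = distr ?M ?M (\<lambda>\<omega>. \<omega>)"
      by (rule distr_cong) (auto simp: s)
    then show "distr ?M (PiM UNIV (\<lambda>_. borel)) (\<lambda>\<omega>. \<lambda>i\<in>UNIV. \<omega> i) =
        PiM UNIV (\<lambda>i. distr ?M borel (\<lambda>\<omega>. \<omega> i))"
      unfolding distr_coordinate by (simp add: spike_noise_space_def)
  qed auto
  then have "indep_vars (\<lambda>_. borel) (\<lambda>t \<omega>. \<omega> t) ({1..} :: nat set)"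
    by (rule indep_vars_subset) simp
  then show ?thesis
    by (simp add: iid_noise_def distr_coordinate)
qed

lemma
  fixes h :: "real \<Rightarrow> real"
  assumes [measurable]: "h \<in> borel_measurable borel" and p: "0 < p" "p < 1"
  shows integrable_coordinate: "integrable (spike_noise_space p a) (\<lambda>\<omega>. h (\<omega> t))"
    and integral_coordinate: "(\<integral>\<omega>. h (\<omega> t) \<partial>spike_noise_space p a) = (\<integral>z. h z \<partial>spike_noise p a)"
proof -
  show "integrable (spike_noise_space p a) (\<lambda>\<omega>. h (\<omega> t))"
    using integrable_spike_noise[OF assms, of a]
    by (intro integrable_distr[OF coordinate_measurable]) (simp only: distr_coordinate)
  show "(\<integral>\<omega>. h (\<omega> t) \<partial>spike_noise_space p a) = (\<integral>z. h z \<partial>spike_noise p a)"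
    using integral_distr[OF coordinate_measurable assms(1), of p a t] by (simp only: distr_coordinate)
qed

text \<open>
  By the union bound only the marginals matter.
\<close>

lemma no_spike_prob:
  assumes "0 < p" "p < 1"
  shows "{\<omega>. \<forall>t\<in>{1..T}. \<omega> t = a} \<in> sets (spike_noise_space p a)" (is "?G \<in> sets ?M")
    and "1 - real T * p \<le> measure (spike_noise_space p a) {\<omega>. \<forall>t\<in>{1..T}. \<omega> t = a}"
proof -
  interpret prob_space ?M by (rule prob_space_spike_noise_space)
  have "{\<omega> \<in> space ?M. \<forall>t\<in>{1..T}. \<omega> t = a} \<in> sets ?M"
    by measurable
  then show G: "?G \<in> sets ?M" by simp
  define E where "E = (\<lambda>t. (\<lambda>\<omega>. \<omega> t) -` (- {a}) \<inter> space ?M)"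
  have E: "E t \<in> sets ?M" for t
    unfolding E_def by (rule measurable_sets[OF coordinate_measurable]) simp
  have "prob (\<Union>t\<in>{1..T}. E t) \<le> (\<Sum>t\<in>{1..T}. prob (E t))"
    by (rule finite_measure_subadditive_finite) (use E in auto)
  also have "\<dots> = (\<Sum>t\<in>{1..T}. measure (spike_noise p a) (- {a}))"
    unfolding E_def
    by (intro sum.cong refl) (subst measure_distr[symmetric, OF coordinate_measurable], auto simp: distr_coordinate)
  also have "\<dots> \<le> (\<Sum>t\<in>{1..T}. p)"
    by (intro sum_mono spike_noise_spike_prob assms)
  finally have "prob (\<Union>t\<in>{1..T}. E t) \<le> real T * p" by simp
  moreover have "prob (space ?M - (\<Union>t\<in>{1..T}. E t)) = 1 - prob (\<Union>t\<in>{1..T}. E t)"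
    using E by (intro prob_compl) auto
  moreover have "space ?M - (\<Union>t\<in>{1..T}. E t) = ?G"
    by (auto simp: E_def)
  ultimately show "1 - real T * p \<le> prob ?G" by simp
qed

section \<open>The lower bound\<close>

lemma eventually_horizon_large:
  fixes \<sigma> C :: real
  assumes "0 < C" "0 < \<sigma>"
  shows "\<forall>\<^sub>F T :: nat in sequentially. C / 2 \<le>
    C * (real T - 1) / real T - \<sigma> / (4 * sqrt (real T)) - (\<sigma> / (4 * sqrt (real T)))\<^sup>2 / 2"
proof -
  have "(\<lambda>T :: nat. C * (real T - 1) / real T - \<sigma> / (4 * sqrt (real T)) - (\<sigma> / (4 * sqrt (real T)))\<^sup>2 / 2)
    \<longlonglongrightarrow> C"
    using assms by real_asymp
  from order_tendstoD(1)[OF this, of "C / 2"] assms show ?thesis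
    by (auto elim: eventually_mono)
qed

text \<open>
  The derivative never goes below \<open>- d\<close>, so the noise value \<open>2 d\<close> outweighs it everywhere and the
  bounds on the gradients need no information about the iterates. The constant \<open>1\<close> subtracted
  from \<open>T\<close> comes from the average displacement \<open>(T - 1) / 2\<close> of \<open>T\<close> iterates, the first of which has
  not moved, and the term \<open>- d\<close> from the start at \<open>1\<close>.
\<close>

lemma huber_left_average_no_spike:
  fixes x g :: "nat \<Rightarrow> real" and T :: nat
  assumes pos: "0 < \<sigma>" "0 < b0" "0 < \<eta>" "1 \<le> T"
    and run: "adagrad_norm \<eta> b0 1 x g"
    and g: "\<And>t. t \<in> {1..T} \<Longrightarrow> g t = clip d (x t) + 2 * d"
    and d: "d = \<sigma> / (4 * sqrt (real T))"
    and C: "C = \<eta> * \<sigma>\<^sup>2 / (64 * sqrt (b0\<^sup>2 + \<sigma>\<^sup>2 / 16))"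
  shows "C * (real T - 1) / real T - d - d\<^sup>2 / 2 \<le> huber_left d (uniform_average x T)"
proof -
  define D where "D = sqrt (b0\<^sup>2 + \<sigma>\<^sup>2 / 16)"
  have D: "0 < D" "D\<^sup>2 = b0\<^sup>2 + \<sigma>\<^sup>2 / 16"
    using pos by (auto simp: D_def intro!: add_pos_pos)
  have d_pos: "0 < d" using pos by (simp add: d)
  have d_sq: "d\<^sup>2 = \<sigma>\<^sup>2 / (16 * real T)"
    using pos by (simp add: d power_divide power_mult_distrib)
  have gb: "d \<le> g t \<and> g t \<le> 2 * d" if "t \<in> {1..T}" for t
    using g[OF that] clip_bounds[of d "x t"] d_pos by auto
  have "(\<Sum>s=1..T. (g s)\<^sup>2) \<le> (\<Sum>s=1..T. (2 * d)\<^sup>2)"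
    using gb d_pos by (intro sum_mono power_mono) force+
  also have "\<dots> = \<sigma>\<^sup>2 / 4"
    using pos by (simp add: power_mult_distrib d_sq)
  finally have "b0\<^sup>2 + (\<Sum>s=1..T. (g s)\<^sup>2) \<le> b0\<^sup>2 + \<sigma>\<^sup>2 / 4" by simp
  \<comment> \<open>A factor of at most \<open>2\<close> is lost in order to compare with \<open>D\<close>, the quantity in the final bound.\<close>
  also have "\<dots> \<le> (2 * D)\<^sup>2"
    by (simp add: power_mult_distrib D)
  finally have R: "b0\<^sup>2 + (\<Sum>s=1..T. (g s)\<^sup>2) \<le> (2 * D)\<^sup>2" .
  have "x (Suc t) \<le> 1 - real t * (\<eta> * d / (2 * D))" if "t < T" for t
    by (rule adagrad_norm_drift[OF run _ _ _ _ _ R]) (use pos d_pos D gb that in auto)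
  then have "uniform_average x T \<le> 1 - (real T - 1) / 2 * (\<eta> * d / (2 * D))"
    by (rule uniform_average_drift[OF pos(4)])
  then have "- d * (1 - (real T - 1) / 2 * (\<eta> * d / (2 * D))) \<le> - d * uniform_average x T"
    using d_pos by simp
  moreover have "- d * uniform_average x T - d\<^sup>2 / 2 \<le> huber_left d (uniform_average x T)"
    using huber_left_ge_affine[of d "- d" "uniform_average x T"] d_pos by simp
  moreover have "- d * (1 - (real T - 1) / 2 * (\<eta> * d / (2 * D)))
      = - d + \<eta> * d\<^sup>2 / (4 * D) * (real T - 1)"
    by (simp add: field_simps power2_eq_square)
  moreover have "\<eta> * d\<^sup>2 / (4 * D) * (real T - 1) = C * (real T - 1) / real T"
    by (simp add: C d_sq flip: D_def)
  ultimately show ?thesis by linarith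
qed

theorem theorem3p8:
  fixes \<sigma> b0 \<eta> :: real
  assumes "\<sigma> > 0" and "b0 > 0" and "\<eta> > 0"
  shows "\<exists>T0::nat. \<forall>T\<ge>T0.
    \<exists>(f :: real \<Rightarrow> real) (M :: (nat \<Rightarrow> real) measure) (\<xi> :: nat \<Rightarrow> (nat \<Rightarrow> real) \<Rightarrow> real).
      convex_on UNIV f \<and> one_smooth f \<and> f 0 = 0 \<and> (\<forall>y. f 0 \<le> f y) \<and>
      prob_space M \<and> iid_noise M \<xi> \<and>
      (\<forall>run \<in> {adagrad_norm \<eta> b0 (1::real), adagrad \<eta> (\<lambda>_. b0) (1::real)}.
        \<exists>x g :: nat \<Rightarrow> (nat \<Rightarrow> real) \<Rightarrow> real.
          (\<forall>\<omega>\<in>space M. run (\<lambda>t. x t \<omega>) (\<lambda>t. g t \<omega>)) \<and>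
          additive_noise_oracle M \<sigma> f \<xi> x g \<and>
          prob_space.expectation M (\<lambda>\<omega>. f (uniform_average (\<lambda>t. x t \<omega>) T) - f 0)
            \<ge> \<eta> * \<sigma>\<^sup>2 / (256 * sqrt (b0\<^sup>2 + \<sigma>\<^sup>2 / 16)))"
proof -
  define C where "C = \<eta> * \<sigma>\<^sup>2 / (64 * sqrt (b0\<^sup>2 + \<sigma>\<^sup>2 / 16))"
  have C: "0 < C" "\<eta> * \<sigma>\<^sup>2 / (256 * sqrt (b0\<^sup>2 + \<sigma>\<^sup>2 / 16)) = C / 4"
    using assms by (auto simp: C_def intro!: divide_pos_pos mult_pos_pos add_pos_pos)
  obtain T0 where T0: "\<And>T. T0 \<le> T \<Longrightarrow> 1 \<le> T \<and> C / 2 \<le>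
      C * (real T - 1) / real T - \<sigma> / (4 * sqrt (real T)) - (\<sigma> / (4 * sqrt (real T)))\<^sup>2 / 2"
    using eventually_conj[OF eventually_ge_at_top[of "1::nat"] eventually_horizon_large[OF C(1) assms(1)]]
    by (auto simp: eventually_sequentially)
  show ?thesis
  proof (intro exI[of _ T0] allI impI)
    fix T assume "T0 \<le> T"
    define d where "d = \<sigma> / (4 * sqrt (real T))"
    define p where "p = 1 / (4 * real T)"
    define M where "M = spike_noise_space p (2 * d)"
    define f where "f = huber_left d"
    define \<xi> where "\<xi> = (\<lambda>(t :: nat) (\<omega> :: nat \<Rightarrow> real). \<omega> t)"
    have T: "1 \<le> T" and val: "C / 2 \<le> C * (real T - 1) / real T - d - d\<^sup>2 / 2"
      using T0[OF \<open>T0 \<le> T\<close>] by (auto simp: d_def)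
    have d: "0 < d" using assms T by (simp add: d_def)
    have p: "0 < p" "p < 1" using T by (auto simp: p_def)
    have [simp]: "space M = UNIV" by (simp add: M_def)
    have f': "deriv f = clip d" using d by (simp add: f_def deriv_huber_left)
    interpret prob_space M
      unfolding M_def by (rule prob_space_spike_noise_space)
    have iid: "iid_noise M \<xi>"
      unfolding M_def \<xi>_def by (rule iid_noise_coordinates)
    have "\<forall>\<omega> :: nat \<Rightarrow> real. \<exists>u v. adagrad_norm \<eta> b0 (1::real) u v \<and>
        (\<forall>t\<ge>1. v t = clip d (u t) + \<omega> t)"
      by (metis adagrad_norm_trajectory)
    then obtain u v :: "(nat \<Rightarrow> real) \<Rightarrow> nat \<Rightarrow> real" where
      uv: "\<And>\<omega>. adagrad_norm \<eta> b0 1 (u \<omega>) (v \<omega>)" "\<And>\<omega> t. 1 \<le> t \<Longrightarrow> v \<omega> t = clip d (u \<omega> t) + \<omega> t"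
      by metis
    define x where "x = (\<lambda>t \<omega>. u \<omega> t)"
    define g where "g = (\<lambda>t \<omega>. v \<omega> t)"
    have run: "adagrad_norm \<eta> b0 1 (\<lambda>t. x t \<omega>) (\<lambda>t. g t \<omega>)" for \<omega>
      using uv(1) by (simp add: x_def g_def)
    have g: "g t \<omega> = clip d (x t \<omega>) + \<xi> t \<omega>" if "1 \<le> t" for t \<omega>
      using uv(2)[OF that] by (simp add: x_def g_def \<xi>_def)
    have is_oracle: "additive_noise_oracle M \<sigma> f \<xi> x g"
    proof (rule additive_noise_oracle_indep[where K = d])
      show "indep_vars (\<lambda>_. borel) \<xi> {1..}"
        using iid by (simp add: iid_noise_def)
      show "integrable M (\<xi> t)" "integrable M (\<lambda>\<omega>. (\<xi> t \<omega>)\<^sup>2)" for t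
        unfolding M_def \<xi>_def using p
        by (auto intro: integrable_coordinate[where h = "\<lambda>z. z"] integrable_coordinate[where h = "\<lambda>z. z\<^sup>2"])
      show "expectation (\<xi> t) = 0" for t
        unfolding M_def \<xi>_def using p integral_coordinate[where h = "\<lambda>z. z"]
        by (simp add: spike_noise_mean)
      have "expectation (\<lambda>\<omega>. (\<xi> t \<omega>)\<^sup>2) = (2 * d)\<^sup>2 * (1 - p) / p" for t
        unfolding M_def \<xi>_def using p integral_coordinate[where h = "\<lambda>z. z\<^sup>2"]
        by (simp add: spike_noise_second_moment)
      also have "(2 * d)\<^sup>2 * (1 - p) / p = \<sigma>\<^sup>2 * (1 - p)"
        using T by (simp add: d_def p_def power_divide power_mult_distrib)
      also have "\<dots> \<le> \<sigma>\<^sup>2"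
        using p by (simp add: mult_left_le)
      finally show "expectation (\<lambda>\<omega>. (\<xi> t \<omega>)\<^sup>2) \<le> \<sigma>\<^sup>2" for t .
      show "\<bar>deriv f y\<bar> \<le> d" for y
        using clip_bounds[of d y] d by (auto simp: f')
      show "adagrad_norm \<eta> b0 1 (\<lambda>t. x t \<omega>) (\<lambda>t. g t \<omega>)" for \<omega>
        by (rule run)
      show "g t \<omega> = deriv f (x t \<omega>) + \<xi> t \<omega>" if "1 \<le> t" for t \<omega>
        unfolding f' by (rule g[OF that])
      show "deriv f \<in> borel_measurable borel"
        unfolding f' by (rule clip_measurable)
    qed
    have x_meas [measurable]: "x t \<in> borel_measurable M" if "1 \<le> t" for t
    proof -
      have \<xi>_meas: "\<xi> s \<in> borel_measurable M" for s
        unfolding \<xi>_def M_def by (rule coordinate_measurable)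
      have "g s \<in> borel_measurable M" if "s \<in> {1..t - 1}" for s
        by (rule adagrad_norm_gradient_measurable[OF run g clip_measurable \<xi>_meas that])
      then have "x (Suc (t - 1)) \<in> borel_measurable M"
        by (rule adagrad_norm_iterate_measurable[OF run])
      then show ?thesis using that by simp
    qed
    define \<phi> where "\<phi> = (\<lambda>\<omega>. f (uniform_average (\<lambda>t. x t \<omega>) T))"
    have \<phi>_meas: "\<phi> \<in> borel_measurable M"
      unfolding \<phi>_def f_def uniform_average_def
      by (intro measurable_compose[OF _ huber_left_measurable] borel_measurable_times
          borel_measurable_sum x_meas) auto
    have \<phi>_nonneg: "0 \<le> \<phi> \<omega>" for \<omega>
      using d by (simp add: \<phi>_def f_def huber_left_nonneg)
    have \<phi>_le: "\<phi> \<omega> \<le> d * (1 + \<eta> * real T)" for \<omega>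
    proof -
      have "\<bar>x t \<omega>\<bar> \<le> 1 + \<eta> * real T" if "t \<in> {1..T}" for t
      proof -
        have "\<bar>x (Suc (t - 1)) \<omega>\<bar> \<le> \<bar>1\<bar> + \<eta> * real (t - 1)"
          using run assms(3) by (intro adagrad_norm_bounded) auto
        moreover have "\<eta> * real (t - 1) \<le> \<eta> * real T"
          using that assms(3) by (intro mult_left_mono) auto
        ultimately show ?thesis using that by simp
      qed
      then have "\<bar>uniform_average (\<lambda>t. x t \<omega>) T\<bar> \<le> 1 + \<eta> * real T"
        by (rule uniform_average_bounded[OF _ T])
      then have "d * \<bar>uniform_average (\<lambda>t. x t \<omega>) T\<bar> \<le> d * (1 + \<eta> * real T)"
        using d by simp
      then show ?thesis
        unfolding \<phi>_def f_def
        using huber_left_le[of d "uniform_average (\<lambda>t. x t \<omega>) T"] d by linarith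
    qed
    have \<phi>_int: "integrable M \<phi>"
      by (rule integrable_const_bound[OF _ \<phi>_meas, of "d * (1 + \<eta> * real T)"]) (use \<phi>_nonneg \<phi>_le in auto)
    define G where "G = {\<omega> :: nat \<Rightarrow> real. \<forall>t\<in>{1..T}. \<omega> t = 2 * d}"
    have G: "G \<in> events" "3 / 4 \<le> prob G"
      using no_spike_prob[OF p, of T "2 * d"] T by (auto simp: G_def M_def p_def)
    have \<phi>_G: "C / 2 \<le> \<phi> \<omega>" if "\<omega> \<in> G" for \<omega>
    proof -
      have "g t \<omega> = clip d (x t \<omega>) + 2 * d" if "t \<in> {1..T}" for t
        using \<open>\<omega> \<in> G\<close> that g[of t \<omega>] by (auto simp: G_def \<xi>_def)
      from huber_left_average_no_spike[OF assms T run this d_def C_def]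
      show ?thesis
        unfolding \<phi>_def f_def by (rule order_trans[OF val])
    qed
    \<comment> \<open>Off the event \<open>G\<close> only nonnegativity of the objective is used.\<close>
    have "C / 4 \<le> C / 2 * prob G"
      using mult_left_mono[OF G(2), of "C / 2"] C(1) by simp
    also have "\<dots> = (\<integral>\<omega>. C / 2 * indicator G \<omega> \<partial>M)"
      using G(1) by simp
    also have "\<dots> \<le> expectation \<phi>"
    proof (rule integral_mono)
      show "integrable M (\<lambda>\<omega>. C / 2 * indicator G \<omega>)"
        using G(1) by (intro integrable_mult_right integrable_real_indicator) (auto simp: emeasure_eq_measure)
      show "C / 2 * indicator G \<omega> \<le> \<phi> \<omega>" for \<omega>
        using \<phi>_G[of \<omega>] \<phi>_nonneg[of \<omega>] by (cases "\<omega> \<in> G") auto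
    qed (rule \<phi>_int)
    finally have bound: "C / 4 \<le> expectation \<phi>" .
    have "\<exists>x g :: nat \<Rightarrow> (nat \<Rightarrow> real) \<Rightarrow> real.
          (\<forall>\<omega>\<in>space M. alg (\<lambda>t. x t \<omega>) (\<lambda>t. g t \<omega>)) \<and>
          additive_noise_oracle M \<sigma> f \<xi> x g \<and>
          expectation (\<lambda>\<omega>. f (uniform_average (\<lambda>t. x t \<omega>) T) - f 0)
            \<ge> \<eta> * \<sigma>\<^sup>2 / (256 * sqrt (b0\<^sup>2 + \<sigma>\<^sup>2 / 16))"
      if "alg \<in> {adagrad_norm \<eta> b0 (1::real), adagrad \<eta> (\<lambda>_. b0) (1::real)}" for alg
      using that run is_oracle bound d
      by (intro exI[of _ x] exI[of _ g]) (auto simp: C(2) adagrad_real_iff \<phi>_def f_def)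
    moreover have "convex_on UNIV f" "one_smooth f" "f 0 = 0" "\<forall>y. f 0 \<le> f y"
      using d by (auto simp: f_def convex_huber_left one_smooth_huber_left huber_left_nonneg)
    ultimately show "\<exists>(f :: real \<Rightarrow> real) (M :: (nat \<Rightarrow> real) measure) (\<xi> :: nat \<Rightarrow> (nat \<Rightarrow> real) \<Rightarrow> real).
      convex_on UNIV f \<and> one_smooth f \<and> f 0 = 0 \<and> (\<forall>y. f 0 \<le> f y) \<and>
      prob_space M \<and> iid_noise M \<xi> \<and>
      (\<forall>run \<in> {adagrad_norm \<eta> b0 (1::real), adagrad \<eta> (\<lambda>_. b0) (1::real)}.
        \<exists>x g :: nat \<Rightarrow> (nat \<Rightarrow> real) \<Rightarrow> real.
          (\<forall>\<omega>\<in>space M. run (\<lambda>t. x t \<omega>) (\<lambda>t. g t \<omega>)) \<and>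
          additive_noise_oracle M \<sigma> f \<xi> x g \<and>
          prob_space.expectation M (\<lambda>\<omega>. f (uniform_average (\<lambda>t. x t \<omega>) T) - f 0)
            \<ge> \<eta> * \<sigma>\<^sup>2 / (256 * sqrt (b0\<^sup>2 + \<sigma>\<^sup>2 / 16)))"
      using iid prob_space_axioms by blast
  qed
qed

end
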